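(* Let $\Gamma=\{g_1,\ldots,g_k\}\subset H^+$ be admissible and let $p=(p_1,\ldots,p_k)$ be a probability distribution on $\Gamma$ with all $p_i>0$. Then the operator $P$ corresponding to the Iterated Function System $(\Gamma,p)$ satisfies the e-property.
   Context: $\mathbf{S}^1$ is the circle with arc length normalized to total length $1$. $H^+$ is the set of orientation preserving homeomorphisms of $\mathbf{S}^1$. $C(\mathbf{S}^1)$ is the space of continuous real functions on $\mathbf{S}^1$ with the supremum norm. $\mathcal{M}_{fin}$ is the set of finite Borel measures on $\mathbf{S}^1$. $\Gamma=\{g_1,\ldots,g_k\}\subset H^+$ is a finite collection and $p(g_i)=p_i>0$, $\sum_i p_i=1$. The Markov operator corresponding to the Iterated Function System $(\Gamma,p)$ is $P:\mathcal{M}_{fin}\to\mathcal{M}_{fin}$, $P\mu=\sum_{i=1}^k p_i\,\mu\circ g_i^{-1}$; its dual operator is $P^*:C(\mathbf{S}^1)\to C(\mathbf{S}^1)$, $P^*f(x)=\sum_{i=1}^k p_i f(g_i(x))$. $P^{*n}$ denotes the $n$-th iterate of $P^*$. $\Gamma$ is admissible if one of its elements, labelled $g_1$, is such that $\{g_1^n(x):n\ge1\}$ is dense in $\mathbf{S}^1$ for some (and thus all) $x\in\mathbf{S}^1$. $P$ satisfies the e-property if for every $x\in\mathbf{S}^1$ and every continuous $f:\mathbf{S}^1\to\mathbb{R}$, $\lim_{y\to x}\sup_{n\in\mathbb{N}}|P^{*n}f(y)-P^{*n}f(x)|=0$. *)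

theory Defs
  imports "HOL-Analysis.Analysis"
begin

text \<open>
  The circle is the unit circle of the complex plane. Normalised arc length corresponds to the
  parametrisation \<open>t \<mapsto> cis (2 * pi * t)\<close> with \<open>t\<close> taken modulo 1; it induces the subspace topology
  used here.
\<close>

abbreviation circle :: "complex set" where
  "circle \<equiv> sphere 0 1"

text \<open>
  A circle homeomorphism preserves orientation iff it lifts along the universal cover to an
  increasing homeomorphism of the line. Functions are made \<open>undefined\<close> off the circle, so that
  distinct elements of \<open>H_plus\<close> differ somewhere on the circle.
\<close>

definition orientation_preserving :: "(complex \<Rightarrow> complex) \<Rightarrow> bool" where
  "orientation_preserving g \<longleftrightarrow>
     (\<exists>F :: real \<Rightarrow> real. continuous_on UNIV F \<and> strict_mono F \<and>
        (\<forall>t. F (t + 1) = F t + 1) \<and>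
        (\<forall>t. g (cis (2 * pi * t)) = cis (2 * pi * F t)))"

definition H_plus :: "(complex \<Rightarrow> complex) set" where
  "H_plus = {g \<in> extensional circle.
     (\<exists>h. homeomorphism circle circle g h) \<and> orientation_preserving g}"

definition circle_borel :: "complex measure" where
  "circle_borel = restrict_space borel circle"

definition M_fin :: "complex measure set" where
  "M_fin = {\<mu>. sets \<mu> = sets circle_borel \<and> finite_measure \<mu>}"

definition admissible :: "(complex \<Rightarrow> complex) set \<Rightarrow> bool" where
  "admissible \<Gamma> \<longleftrightarrow>
     (\<exists>g\<in>\<Gamma>. \<exists>x\<in>circle. circle \<subseteq> closure {(g ^^ n) x |n. n \<ge> 1})"

definition markov_operator ::
  "(complex \<Rightarrow> complex) set \<Rightarrow> ((complex \<Rightarrow> complex) \<Rightarrow> real) \<Rightarrow> complex measure \<Rightarrow> complex measure"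
  where
  "markov_operator \<Gamma> p \<mu> = measure_of circle (sets circle_borel)
     (\<lambda>A. \<Sum>g\<in>\<Gamma>. ennreal (p g) * emeasure \<mu> (g -` A \<inter> circle))"

definition dual_operator ::
  "(complex \<Rightarrow> complex) set \<Rightarrow> ((complex \<Rightarrow> complex) \<Rightarrow> real) \<Rightarrow> (complex \<Rightarrow> real) \<Rightarrow> complex \<Rightarrow> real"
  where
  "dual_operator \<Gamma> p f x = (\<Sum>g\<in>\<Gamma>. p g * f (g x))"

text \<open>
  The e-property of the Markov operator \<open>markov_operator \<Gamma> p\<close> is a condition on the iterates of
  its dual; that \<open>dual_operator \<Gamma> p\<close> is this dual is lemma \<open>integral_markov_operator\<close> below.
  The supremum is one of a bounded set of reals, see \<open>bdd_above_dual_operator_iterates\<close>.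
\<close>

definition e_property ::
  "(complex \<Rightarrow> complex) set \<Rightarrow> ((complex \<Rightarrow> complex) \<Rightarrow> real) \<Rightarrow> bool" where
  "e_property \<Gamma> p \<longleftrightarrow>
     (\<forall>x\<in>circle. \<forall>f. continuous_on circle f \<longrightarrow>
        ((\<lambda>y. SUP n. \<bar>(dual_operator \<Gamma> p ^^ n) f y - (dual_operator \<Gamma> p ^^ n) f x\<bar>)
           \<longlongrightarrow> 0) (at x within circle))"

lemma H_plusD:
  assumes "g \<in> H_plus"
  shows "continuous_on circle g" and "g ` circle = circle"
  using assms by (auto simp: H_plus_def homeomorphism_def)

lemma space_circle_borel [simp]: "space circle_borel = circle"
  by (simp add: circle_borel_def space_restrict_space)

lemma continuous_on_circle_bounded:
  fixes h :: "complex \<Rightarrow> real"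
  assumes "continuous_on circle h"
  obtains B where "\<And>x. x \<in> circle \<Longrightarrow> \<bar>h x\<bar> \<le> B"
proof -
  have "bounded (h ` circle)"
    using compact_imp_bounded[OF compact_continuous_image[OF assms compact_sphere]] .
  then obtain B where "\<forall>y\<in>h ` circle. norm y \<le> B"
    unfolding bounded_iff by blast
  then have "\<bar>h x\<bar> \<le> B" if "x \<in> circle" for x
    using that unfolding real_norm_def by blast
  then show thesis using that by blast
qed

lemma borel_measurable_circle_borel:
  fixes f :: "complex \<Rightarrow> 'b :: topological_space"
  assumes "continuous_on circle f"
  shows "f \<in> borel_measurable circle_borel"
  using borel_measurable_continuous_on_restrict[OF assms] by (simp add: circle_borel_def)

lemma H_plus_measurable:
  assumes "g \<in> H_plus"
  shows "g \<in> measurable circle_borel circle_borel"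
proof -
  have "g \<in> borel_measurable circle_borel"
    using borel_measurable_circle_borel H_plusD(1)[OF assms] .
  moreover have "g \<in> circle \<rightarrow> circle"
    using H_plusD(2)[OF assms] by blast
  ultimately show ?thesis
    unfolding circle_borel_def by (intro measurable_restrict_space2)
      (auto simp: space_restrict_space circle_borel_def)
qed

lemma sets_markov_operator [simp]: "sets (markov_operator \<Gamma> p \<mu>) = sets circle_borel"
  and space_markov_operator [simp]: "space (markov_operator \<Gamma> p \<mu>) = circle"
  using sets.sets_measure_of_eq[of circle_borel] sets.space_measure_of_eq[of circle_borel]
  by (simp_all add: markov_operator_def)

lemma emeasure_markov_operator:
  assumes \<Gamma>: "finite \<Gamma>" "\<Gamma> \<subseteq> H_plus" and \<mu>: "sets \<mu> = sets circle_borel"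
    and A: "A \<in> sets circle_borel"
  shows "emeasure (markov_operator \<Gamma> p \<mu>) A
       = (\<Sum>g\<in>\<Gamma>. ennreal (p g) * emeasure \<mu> (g -` A \<inter> circle))"
proof -
  let ?m = "\<lambda>A. \<Sum>g\<in>\<Gamma>. ennreal (p g) * emeasure \<mu> (g -` A \<inter> circle)"
  have sp: "space \<mu> = circle"
    using sets_eq_imp_space_eq[OF \<mu>] by simp
  have "countably_additive (sets circle_borel) ?m"
  proof (rule countably_additiveI)
    fix B :: "nat \<Rightarrow> complex set"
    assume B: "range B \<subseteq> sets circle_borel" "disjoint_family B"
    have one: "(\<Sum>i. emeasure \<mu> (g -` B i \<inter> circle)) = emeasure \<mu> (g -` \<Union> (range B) \<inter> circle)"
      if "g \<in> \<Gamma>" for g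
    proof -
      have "g -` B i \<inter> circle \<in> sets \<mu>" for i
        using measurable_sets[OF H_plus_measurable, of g "B i"] that \<Gamma> B \<mu> by auto
      then have "(\<Sum>i. emeasure \<mu> (g -` B i \<inter> circle)) = emeasure \<mu> (\<Union>i. g -` B i \<inter> circle)"
        using B(2) by (intro suminf_emeasure) (auto simp: disjoint_family_on_def)
      also have "(\<Union>i. g -` B i \<inter> circle) = g -` \<Union> (range B) \<inter> circle"
        by auto
      finally show ?thesis .
    qed
    have "(\<Sum>i. ?m (B i)) = (\<Sum>g\<in>\<Gamma>. \<Sum>i. ennreal (p g) * emeasure \<mu> (g -` B i \<inter> circle))"
      by (rule suminf_sum) auto
    also have "\<dots> = ?m (\<Union> (range B))"
      by (rule sum.cong) (simp_all add: one)
    finally show "(\<Sum>i. ?m (B i)) = ?m (\<Union> (range B))" .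
  qed
  moreover have "positive (sets circle_borel) ?m"
    by (simp add: positive_def)
  moreover have "sigma_algebra circle (sets circle_borel)"
    using sets.sigma_algebra_axioms[of circle_borel] by simp
  ultimately show ?thesis
    unfolding markov_operator_def using A by (intro emeasure_measure_of_sigma)
qed

lemma markov_operator_M_fin:
  assumes \<Gamma>: "finite \<Gamma>" "\<Gamma> \<subseteq> H_plus" and \<mu>: "\<mu> \<in> M_fin"
  shows "markov_operator \<Gamma> p \<mu> \<in> M_fin"
proof -
  have "finite_measure \<mu>" and s: "sets \<mu> = sets circle_borel"
    using \<mu> by (auto simp: M_fin_def)
  interpret finite_measure \<mu> by fact
  have "emeasure (markov_operator \<Gamma> p \<mu>) circle \<noteq> \<infinity>"
    using \<Gamma> s sets.top[of circle_borel]
    by (subst emeasure_markov_operator) (auto simp: ennreal_mult_eq_top_iff)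
  then show ?thesis
    by (auto simp: M_fin_def intro!: finite_measureI)
qed

lemma nn_integral_markov_operator:
  assumes \<Gamma>: "finite \<Gamma>" "\<Gamma> \<subseteq> H_plus" and \<mu>: "sets \<mu> = sets circle_borel"
    and f: "f \<in> borel_measurable circle_borel"
  shows "(\<integral>\<^sup>+x. f x \<partial>markov_operator \<Gamma> p \<mu>) = (\<Sum>g\<in>\<Gamma>. ennreal (p g) * (\<integral>\<^sup>+x. f (g x) \<partial>\<mu>))"
proof -
  have sp: "space \<mu> = circle"
    using sets_eq_imp_space_eq[OF \<mu>] by simp
  have g: "g \<in> measurable \<mu> circle_borel" if "g \<in> \<Gamma>" for g
    using H_plus_measurable[of g] that \<Gamma> \<mu> by (auto cong: measurable_cong_sets)
  have m: "u \<in> borel_measurable (markov_operator \<Gamma> p \<mu>)"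
    if "u \<in> borel_measurable circle_borel" for u :: "complex \<Rightarrow> ennreal"
    using that by (simp cong: measurable_cong_sets)
  have c: "(\<lambda>x. u (g x)) \<in> borel_measurable \<mu>"
    if "u \<in> borel_measurable circle_borel" "g \<in> \<Gamma>" for u :: "complex \<Rightarrow> ennreal" and g
    using measurable_compose[OF g[OF that(2)] that(1)] .
  have gc: "g x \<in> circle" if "g \<in> \<Gamma>" "x \<in> circle" for g x
    using H_plusD(2)[of g] that \<Gamma> by blast
  from f show ?thesis
  proof (induction rule: borel_measurable_induct)
    case (cong u v)
    have "(\<integral>\<^sup>+x. u x \<partial>markov_operator \<Gamma> p \<mu>) = (\<integral>\<^sup>+x. v x \<partial>markov_operator \<Gamma> p \<mu>)"
      using cong by (intro nn_integral_cong) simp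
    moreover have "(\<integral>\<^sup>+x. u (g x) \<partial>\<mu>) = (\<integral>\<^sup>+x. v (g x) \<partial>\<mu>)" if "g \<in> \<Gamma>" for g
      using cong gc[OF that] by (intro nn_integral_cong) (simp add: sp)
    ultimately show ?case using cong by simp
  next
    case (set A)
    have "(\<integral>\<^sup>+x. indicator A (g x) \<partial>\<mu>) = emeasure \<mu> (g -` A \<inter> circle)" if "g \<in> \<Gamma>" for g
    proof -
      have "(\<integral>\<^sup>+x. indicator A (g x) \<partial>\<mu>) = (\<integral>\<^sup>+x. indicator (g -` A \<inter> circle) x \<partial>\<mu>)"
        by (intro nn_integral_cong) (auto simp: sp split: split_indicator)
      then show ?thesis
        using measurable_sets[OF g[OF that] set] by (simp add: sp)
    qed
    then show ?case
      using set \<Gamma> \<mu> by (simp add: emeasure_markov_operator)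
  next
    case (mult u a)
    then show ?case
      by (simp add: nn_integral_cmult m c sum_distrib_left mult.left_commute)
  next
    case (add u v)
    then show ?case
      by (simp add: nn_integral_add m c distrib_left sum.distrib)
  next
    case (seq U)
    have inc: "incseq (\<lambda>i x. U i (g x))" for g :: "complex \<Rightarrow> complex"
      using \<open>incseq U\<close> by (auto simp: incseq_def le_fun_def)
    have "(\<integral>\<^sup>+x. (SUP i. U i) x \<partial>markov_operator \<Gamma> p \<mu>)
        = (SUP i. \<integral>\<^sup>+x. U i x \<partial>markov_operator \<Gamma> p \<mu>)"
      unfolding SUP_apply using \<open>incseq U\<close> m[OF seq(1)]
      by (rule nn_integral_monotone_convergence_SUP)
    also have "\<dots> = (SUP i. \<Sum>g\<in>\<Gamma>. ennreal (p g) * (\<integral>\<^sup>+x. U i (g x) \<partial>\<mu>))"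
      using seq by simp
    also have "\<dots> = (\<Sum>g\<in>\<Gamma>. SUP i. ennreal (p g) * (\<integral>\<^sup>+x. U i (g x) \<partial>\<mu>))"
      using inc by (intro ennreal_SUP_sum)
        (auto simp: incseq_def le_fun_def intro!: mult_left_mono nn_integral_mono)
    also have "\<dots> = (\<Sum>g\<in>\<Gamma>. ennreal (p g) * (\<integral>\<^sup>+x. (SUP i. U i) (g x) \<partial>\<mu>))"
    proof (rule sum.cong)
      fix g assume "g \<in> \<Gamma>"
      then have "(\<integral>\<^sup>+x. (SUP i. U i (g x)) \<partial>\<mu>) = (SUP i. \<integral>\<^sup>+x. U i (g x) \<partial>\<mu>)"
        using inc c[OF seq(1)] by (intro nn_integral_monotone_convergence_SUP)
      then show "(SUP i. ennreal (p g) * (\<integral>\<^sup>+x. U i (g x) \<partial>\<mu>))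
          = ennreal (p g) * (\<integral>\<^sup>+x. (SUP i. U i) (g x) \<partial>\<mu>)"
        unfolding SUP_apply by (simp add: SUP_mult_left_ennreal)
    qed simp
    finally show ?case .
  qed
qed

lemma continuous_on_dual_operator:
  assumes "\<Gamma> \<subseteq> H_plus" and "continuous_on circle f"
  shows "continuous_on circle (dual_operator \<Gamma> p f)"
  unfolding dual_operator_def
proof (intro continuous_intros)
  fix g assume "g \<in> \<Gamma>"
  then have "g \<in> H_plus" using assms(1) by blast
  then show "continuous_on circle (\<lambda>x. f (g x))"
    using H_plusD[of g] assms(2) by (intro continuous_on_compose2[of circle f circle g]) auto
qed

lemma integral_markov_operator:
  assumes \<Gamma>: "finite \<Gamma>" "\<Gamma> \<subseteq> H_plus" and p: "\<And>g. g \<in> \<Gamma> \<Longrightarrow> p g \<ge> 0"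
    and \<mu>: "\<mu> \<in> M_fin" and f: "continuous_on circle f"
  shows "(\<integral>x. dual_operator \<Gamma> p f x \<partial>\<mu>) = (\<integral>x. f x \<partial>markov_operator \<Gamma> p \<mu>)"
proof -
  have s: "sets \<mu> = sets circle_borel" and fin: "finite_measure \<mu>"
    using \<mu> by (auto simp: M_fin_def)
  have int: "integrable \<nu> h" if \<nu>: "\<nu> \<in> M_fin" and h: "continuous_on circle h"
    for \<nu> and h :: "complex \<Rightarrow> real"
  proof -
    from \<nu> have sn: "sets \<nu> = sets circle_borel" and "finite_measure \<nu>"
      by (auto simp: M_fin_def)
    interpret finite_measure \<nu> by fact
    have "space \<nu> = circle" using sets_eq_imp_space_eq[OF sn] by simp
    moreover obtain B where "\<And>x. x \<in> circle \<Longrightarrow> \<bar>h x\<bar> \<le> B"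
      using continuous_on_circle_bounded[OF h] by blast
    ultimately show ?thesis
      using borel_measurable_circle_borel[OF h] sn
      by (intro integrable_const_bound[of _ B]) (auto cong: measurable_cong_sets)
  qed
  have fg: "continuous_on circle (\<lambda>x. f (g x))" if "g \<in> \<Gamma>" for g
    using H_plusD[of g] f that \<Gamma> by (intro continuous_on_compose2[of circle f circle g]) auto
  have pos: "enn2real (\<integral>\<^sup>+x. ennreal (h x) \<partial>markov_operator \<Gamma> p \<mu>)
      = (\<Sum>g\<in>\<Gamma>. p g * enn2real (\<integral>\<^sup>+x. ennreal (h (g x)) \<partial>\<mu>))"
    if h: "continuous_on circle h" for h
  proof -
    have hg: "continuous_on circle (\<lambda>x. h (g x))" if "g \<in> \<Gamma>" for g
      using H_plusD[of g] h that \<Gamma> by (intro continuous_on_compose2[of circle h circle g]) auto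
    have fi: "(\<integral>\<^sup>+x. ennreal (h (g x)) \<partial>\<mu>) < \<infinity>" if "g \<in> \<Gamma>" for g
      using integrableD(2)[OF int[OF \<mu> hg[OF that]]] by (simp add: top.not_eq_extremum)
    have eq: "(\<integral>\<^sup>+x. ennreal (h x) \<partial>markov_operator \<Gamma> p \<mu>)
        = (\<Sum>g\<in>\<Gamma>. ennreal (p g) * (\<integral>\<^sup>+x. ennreal (h (g x)) \<partial>\<mu>))"
      using borel_measurable_circle_borel[OF h] by (intro nn_integral_markov_operator \<Gamma> s) auto
    have t: "ennreal (p g) * (\<integral>\<^sup>+x. ennreal (h (g x)) \<partial>\<mu>) < top" if "g \<in> \<Gamma>" for g
      using fi[OF that] by (simp add: ennreal_mult_less_top)
    show ?thesis
      unfolding eq using p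
      by (subst enn2real_sum[OF t]) (auto simp: enn2real_mult intro!: sum.cong)
  qed
  have "(\<integral>x. f x \<partial>markov_operator \<Gamma> p \<mu>)
      = (\<Sum>g\<in>\<Gamma>. p g * enn2real (\<integral>\<^sup>+x. ennreal (f (g x)) \<partial>\<mu>))
      - (\<Sum>g\<in>\<Gamma>. p g * enn2real (\<integral>\<^sup>+x. ennreal (- f (g x)) \<partial>\<mu>))"
    using pos[OF f] pos[OF continuous_on_minus[OF f]]
    by (subst real_lebesgue_integral_def[OF int[OF markov_operator_M_fin[OF \<Gamma> \<mu>] f]]) simp
  also have "\<dots> = (\<Sum>g\<in>\<Gamma>. p g * (\<integral>x. f (g x) \<partial>\<mu>))"
    unfolding sum_subtractf[symmetric] right_diff_distrib[symmetric]
    by (intro sum.cong) (simp_all add: real_lebesgue_integral_def[OF int[OF \<mu> fg]])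
  also have "\<dots> = (\<integral>x. dual_operator \<Gamma> p f x \<partial>\<mu>)"
    unfolding dual_operator_def using int[OF \<mu> fg] by simp
  finally show ?thesis by simp
qed

lemma bdd_above_dual_operator_iterates:
  assumes \<Gamma>: "\<Gamma> \<subseteq> H_plus" and p: "\<And>g. g \<in> \<Gamma> \<Longrightarrow> p g > 0" "sum p \<Gamma> = 1"
    and f: "continuous_on circle f" and xy: "x \<in> circle" "y \<in> circle"
  shows "bdd_above (range (\<lambda>n. \<bar>(dual_operator \<Gamma> p ^^ n) f y - (dual_operator \<Gamma> p ^^ n) f x\<bar>))"
proof -
  obtain B where B: "\<And>z. z \<in> circle \<Longrightarrow> \<bar>f z\<bar> \<le> B"
    using continuous_on_circle_bounded[OF f] by blast
  have bound: "\<bar>(dual_operator \<Gamma> p ^^ n) f z\<bar> \<le> B" if "z \<in> circle" for n z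
    using that
  proof (induction n arbitrary: z)
    case 0
    then show ?case using B by simp
  next
    case (Suc n)
    have "\<bar>(dual_operator \<Gamma> p ^^ Suc n) f z\<bar> \<le> (\<Sum>g\<in>\<Gamma>. \<bar>p g * (dual_operator \<Gamma> p ^^ n) f (g z)\<bar>)"
      by (simp add: dual_operator_def)
    also have "\<dots> \<le> (\<Sum>g\<in>\<Gamma>. p g * B)"
    proof (rule sum_mono)
      fix g assume "g \<in> \<Gamma>"
      moreover from this have "g z \<in> circle"
        using H_plusD(2)[of g] \<Gamma> Suc.prems by blast
      ultimately show "\<bar>p g * (dual_operator \<Gamma> p ^^ n) f (g z)\<bar> \<le> p g * B"
        using Suc.IH[of "g z"] p(1)[of g] by (simp add: abs_mult)
    qed
    also have "\<dots> = B"
      by (simp add: sum_distrib_right[symmetric] p(2))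
    finally show ?case .
  qed
  show ?thesis
  proof (rule bdd_aboveI2)
    fix n
    show "\<bar>(dual_operator \<Gamma> p ^^ n) f y - (dual_operator \<Gamma> p ^^ n) f x\<bar> \<le> 2 * B"
      using bound[OF xy(1), of n] bound[OF xy(2), of n] by linarith
  qed
qed

end

theory Submission
  imports Defs
begin

text \<open>
  Let \<open>G\<close> be the lifted distribution function of a measure \<open>\<mu>\<close> with \<open>\<mu> = (\<Sum>i. p i * \<mu> \<circ> g i)\<close>, that is,
  one stationary for the inverse system. If \<open>\<mu>\<close> has no atoms and full support, then for every
  \<open>r > 0\<close> uniform continuity gives \<open>\<bar>f y - f x\<bar> \<le> r + C * \<mu> [x, y]\<close> for some constant \<open>C\<close>. Since
  \<open>\<mu> [x, y]\<close> is the average of the \<open>\<mu> (g i [x, y])\<close>, this estimate is inherited by all iterates of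
  the dual operator with the same constants, and the right-hand side is at most \<open>2 * r\<close> for \<open>y\<close>
  close to \<open>x\<close>. A homeomorphism with a dense orbit has no periodic points, which excludes atoms of
  \<open>\<mu>\<close> and gaps in its support.
\<close>

section \<open>Lifts of circle homeomorphisms\<close>

definition circle_lift :: "(real \<Rightarrow> real) \<Rightarrow> bool" where
  "circle_lift F \<longleftrightarrow> continuous_on UNIV F \<and> strict_mono F \<and> (\<forall>t. F (t + 1) = F t + 1)"

definition dense_lifted_orbit :: "(real \<Rightarrow> real) \<Rightarrow> real \<Rightarrow> bool" where
  "dense_lifted_orbit F x \<longleftrightarrow>
     (\<forall>c d. c < d \<longrightarrow> (\<exists>n. \<exists>k::int. c < (F ^^ n) x + k \<and> (F ^^ n) x + k < d))"

lemma funpow_funpow: "(f ^^ a) ((f ^^ b) x) = (f ^^ (a + b)) x"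
  by (simp add: funpow_add)

lemma plus_one_imp_plus_int:
  fixes h :: "real \<Rightarrow> real" and t :: real and k :: int
  assumes "\<And>t. h (t + 1) = h t + 1"
  shows "h (t + k) = h t + k"
proof (induction k rule: int_induct[where k = 0])
  case (step1 i)
  then show ?case using assms[of "t + i"] by (simp add: add.assoc)
next
  case (step2 i)
  then show ?case using assms[of "t + (i - 1)"] by (simp add: algebra_simps)
qed simp

lemma circle_lift_plus_int:
  fixes t :: real and k :: int
  assumes "circle_lift F"
  shows "F (t + k) = F t + k"
  using assms by (intro plus_one_imp_plus_int) (simp add: circle_lift_def)

lemma circle_lift_less: "circle_lift F \<Longrightarrow> F s < F t \<longleftrightarrow> s < t"
  by (simp add: circle_lift_def strict_mono_less)

lemma circle_lift_le: "circle_lift F \<Longrightarrow> F s \<le> F t \<longleftrightarrow> s \<le> t"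
  by (simp add: circle_lift_def strict_mono_less_eq)

lemma circle_lift_isCont: "circle_lift F \<Longrightarrow> isCont F t"
  by (simp add: circle_lift_def continuous_on_eq_continuous_at)

lemma circle_lift_funpow: "circle_lift F \<Longrightarrow> circle_lift (F ^^ n)"
proof (induction n)
  case 0
  then show ?case by (simp add: circle_lift_def strict_mono_def)
next
  case (Suc n)
  then have "continuous_on UNIV (F \<circ> (F ^^ n))"
    by (intro continuous_on_compose) (auto simp: circle_lift_def intro: continuous_on_subset)
  with Suc show ?case
    by (auto simp: circle_lift_def strict_mono_def)
qed

lemma circle_lift_diff_int: "circle_lift F \<Longrightarrow> circle_lift (\<lambda>t. F t - of_int m)"
  by (auto simp: circle_lift_def strict_mono_def intro!: continuous_intros)

text \<open>\<open>F ^^ q\<close> commutes with integer translations, so the shifts by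
  \<open>m\<close> collect outside the iterate.\<close>

lemma funpow_diff_int:
  fixes F :: "real \<Rightarrow> real" and m :: int
  assumes "circle_lift F"
  shows "((\<lambda>t. (F ^^ q) t - m) ^^ a) t = (F ^^ (a * q)) t - a * m"
proof (induction a)
  case (Suc a)
  have "(F ^^ q) ((F ^^ (a * q)) t - a * m) = (F ^^ q) ((F ^^ (a * q)) t) - a * m"
    using circle_lift_plus_int[OF circle_lift_funpow[OF assms], of q _ "- (int a * m)"] by simp
  moreover have "((\<lambda>t. (F ^^ q) t - m) ^^ a) t = (F ^^ (a * q)) t - a * m"
    by (rule Suc)
  ultimately show ?case
    by (simp add: funpow_add) (simp add: algebra_simps)
qed simp

text \<open>\<open>t\<close> lies between its floor and its ceiling, where \<open>h\<close> differs
  from \<open>h 0\<close> by exactly that integer. The bound is the same for all such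
  \<open>h\<close>, which later confines all Cesaro averages to one compact box.\<close>

lemma mono_plus_one_deviation:
  assumes "mono h" "\<And>t. h (t + 1) = h t + (1::real)"
  shows "\<bar>h t - h 0\<bar> \<le> \<bar>t\<bar> + 1"
proof -
  have "h (of_int \<lfloor>t\<rfloor>) \<le> h t" "h t \<le> h (of_int \<lceil>t\<rceil>)"
    using assms(1) by (simp_all add: monoD)
  moreover have "h (of_int k) = h 0 + of_int k" for k
    using plus_one_imp_plus_int[of h 0 k] assms(2) by simp
  ultimately have "of_int \<lfloor>t\<rfloor> \<le> h t - h 0" "h t - h 0 \<le> of_int \<lceil>t\<rceil>"
    by auto
  then show ?thesis by linarith
qed

section \<open>Dense orbits and periodic points\<close>

text \<open>If there were finitely many, the interval from \<open>c\<close> to the smallest of them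
  would contain none. Inserting \<open>d\<close> gives the minimum a meaning in any case.\<close>

lemma dense_lifted_orbit_infinite:
  assumes "dense_lifted_orbit F x" "c < d"
  shows "infinite {y. c < y \<and> y < d \<and> (\<exists>n. \<exists>k::int. y = (F ^^ n) x + k)}" (is "infinite ?S")
proof
  assume fin: "finite ?S"
  define e where "e = Min (insert d ?S)"
  have "c < e" "e \<le> d" and min: "\<And>y. y \<in> ?S \<Longrightarrow> e \<le> y"
    using fin assms(2) by (auto simp: e_def)
  obtain n k where "c < (F ^^ n) x + of_int k" "(F ^^ n) x + of_int k < e"
    using assms(1) \<open>c < e\<close> unfolding dense_lifted_orbit_def by blast
  with min[of "(F ^^ n) x + of_int k"] \<open>e \<le> d\<close> show False by fastforce
qed

lemma dense_lifted_orbit_shift: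
  assumes "circle_lift F" "dense_lifted_orbit F x"
  shows "dense_lifted_orbit F (x + of_int k)"
  unfolding dense_lifted_orbit_def
proof (intro allI impI)
  fix c d :: real
  assume "c < d"
  then obtain n l where "c < (F ^^ n) x + of_int l" "(F ^^ n) x + of_int l < d"
    using assms(2) unfolding dense_lifted_orbit_def by blast
  then have "c < (F ^^ n) (x + of_int k) + of_int (l - k)"
      "(F ^^ n) (x + of_int k) + of_int (l - k) < d"
    using circle_lift_plus_int[OF circle_lift_funpow[OF assms(1)]] by simp_all
  then show "\<exists>n. \<exists>l::int. c < (F ^^ n) (x + of_int k) + l \<and> (F ^^ n) (x + of_int k) + l < d"
    by blast
qed

lemma funpow_ge:
  fixes H :: "real \<Rightarrow> real"
  assumes "mono H" "x \<le> H x"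
  shows "x \<le> (H ^^ a) x"
proof (induction a)
  case (Suc a)
  then show ?case using assms(2) monoD[OF assms(1), of x "(H ^^ a) x"] by simp
qed simp

lemma funpow_le:
  fixes H :: "real \<Rightarrow> real"
  assumes "mono H" "H x \<le> x"
  shows "(H ^^ a) x \<le> x"
proof (induction a)
  case (Suc a)
  then show ?case using assms(2) monoD[OF assms(1), of "(H ^^ a) x" x] by simp
qed simp

text \<open>
  If \<open>H = F ^^ q - m\<close> fixes \<open>z\<close>, then \<open>H\<close> moves the points of the orbit monotonically inside
  \<open>{z..z + 1}\<close>, so a fundamental domain of this motion contains at most one orbit point for each
  residue of the time modulo \<open>q\<close>.
\<close>

lemma dense_orbit_no_periodic_point:
  fixes m :: int
  assumes F: "circle_lift F" and dense: "dense_lifted_orbit F x" and q: "q \<ge> 1"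
  shows "(F ^^ q) z \<noteq> z + m"
proof
  assume per: "(F ^^ q) z = z + m"
  define H where "H = (\<lambda>t. (F ^^ q) t - m)"
  have H: "circle_lift H" unfolding H_def
    by (intro circle_lift_diff_int circle_lift_funpow F)
  have monoH: "mono H" using H by (simp add: circle_lift_def strict_mono_mono)
  have Ha: "(H ^^ a) t = (F ^^ (a * q)) t - a * m" for a t
    unfolding H_def by (rule funpow_diff_int[OF F])
  have "H z = z" using per by (simp add: H_def)
  then have fixz: "(H ^^ a) z = z" for a by (induction a) auto
  then have fixz1: "(H ^^ a) (z + 1) = z + 1" for a
    using circle_lift_funpow[OF H] by (simp add: circle_lift_def)
  \<comment> \<open>The integer translate of \<open>x\<close> in the period that starts at
    \<open>z\<close>; both ends of this period are fixed by \<open>H\<close>.\<close>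
  define x0 where "x0 = x + of_int (- \<lfloor>x - z\<rfloor>)"
  have x0: "z \<le> x0" "x0 < z + 1" unfolding x0_def by linarith+
  have dense0: "dense_lifted_orbit F x0"
    unfolding x0_def by (rule dense_lifted_orbit_shift[OF F dense])
  define orb where "orb y \<longleftrightarrow> (\<exists>n. \<exists>k::int. y = (F ^^ n) x0 + k)" for y
  have Hx0: "z \<le> H x0" "H x0 < z + 1"
    using x0 fixz[of 1] fixz1[of 1] circle_lift_le[OF H, of z x0] circle_lift_less[OF H, of x0 "z + 1"]
    by simp_all
  \<comment> \<open>An orbit point can come back to this window under \<open>H\<close> only as
    itself. If \<open>H\<close> fixes \<open>x0\<close>, it fixes every orbit point, as powers of
    \<open>F\<close> commute; otherwise the window lies between \<open>x0\<close> and
    \<open>H x0\<close>, and one step of \<open>H\<close> leaves it for good.\<close>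
  have "\<exists>c d. z \<le> c \<and> c < d \<and> d \<le> z + 1 \<and>
      (\<forall>y a. orb y \<and> c < y \<and> y < d \<and> c < (H ^^ a) y \<and> (H ^^ a) y < d \<longrightarrow> (H ^^ a) y = y)"
  proof (cases "H x0" x0 rule: linorder_cases)
    case equal
    have "(H ^^ a) y = y" if "orb y" for y a
    proof -
      obtain n and k :: int where y: "y = (F ^^ n) x0 + k" using \<open>orb y\<close> by (auto simp: orb_def)
      have "H y = (F ^^ n) (H x0) + k"
      proof -
        have "(F ^^ q) ((F ^^ n) x0) = (F ^^ n) ((F ^^ q) x0)"
          by (simp add: funpow_funpow add.commute)
        then show ?thesis
          using circle_lift_plus_int[OF circle_lift_funpow[OF F], of q "(F ^^ n) x0" k]
            circle_lift_plus_int[OF circle_lift_funpow[OF F], of n "(F ^^ q) x0" "- m"]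
          by (simp add: y H_def)
      qed
      then have "H y = y" using equal y by simp
      then show ?thesis by (induction a) auto
    qed
    then show ?thesis by (intro exI[of _ z] exI[of _ "z + 1"]) auto
  next
    case greater
    have "(H ^^ a) y = y" if "x0 < y" "y < H x0" "(H ^^ a) y < H x0" for y a
    proof (cases a)
      case (Suc b)
      have "H x0 \<le> (H ^^ b) (H x0)"
        using greater monoH by (intro funpow_ge) (simp_all add: monoD)
      also have "\<dots> = (H ^^ a) x0" by (simp add: Suc funpow_swap1)
      also have "\<dots> < (H ^^ a) y"
        using that circle_lift_less[OF circle_lift_funpow[OF H]] by simp
      finally show ?thesis using that by simp
    qed simp
    then show ?thesis using x0 Hx0 greater by (intro exI[of _ x0] exI[of _ "H x0"]) auto
  next
    case less
    have "(H ^^ a) y = y" if "y < x0" "H x0 < y" "H x0 < (H ^^ a) y" for y a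
    proof (cases a)
      case (Suc b)
      have "(H ^^ a) y < (H ^^ a) x0"
        using that circle_lift_less[OF circle_lift_funpow[OF H]] by simp
      also have "\<dots> = (H ^^ b) (H x0)" by (simp add: Suc funpow_swap1)
      also have "\<dots> \<le> H x0"
        using less monoH by (intro funpow_le) (simp_all add: monoD)
      finally show ?thesis using that by simp
    qed simp
    then show ?thesis using x0 Hx0 less by (intro exI[of _ "H x0"] exI[of _ x0]) auto
  qed
  then obtain c d where cd: "z \<le> c" "c < d" "d \<le> z + 1"
    and once: "\<And>y a. \<lbrakk>orb y; c < y; y < d; c < (H ^^ a) y; (H ^^ a) y < d\<rbrakk> \<Longrightarrow> (H ^^ a) y = y"
    by blast
  define S where "S = {y. c < y \<and> y < d \<and> orb y}"
  have "infinite S"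
    unfolding S_def orb_def by (rule dense_lifted_orbit_infinite[OF dense0 \<open>c < d\<close>])
  have "\<forall>y\<in>S. \<exists>n. \<exists>k::int. y = (F ^^ n) x0 + k" by (auto simp: S_def orb_def)
  then obtain \<tau> \<kappa> where \<tau>: "\<And>y. y \<in> S \<Longrightarrow> y = (F ^^ \<tau> y) x0 + of_int (\<kappa> y)" by metis
  \<comment> \<open>Times that agree modulo \<open>q\<close> make \<open>y'\<close> an integer
    translate of some \<open>(H ^^ a) y\<close>. Both points lie strictly between the fixed points
    \<open>z\<close> and \<open>z + 1\<close>, so the integer is 0.\<close>
  have same: "y' = y"
    if "y \<in> S" "y' \<in> S" "\<tau> y mod q = \<tau> y' mod q" "\<tau> y \<le> \<tau> y'" for y y'
  proof -
    have "q dvd \<tau> y' - \<tau> y" using that(3,4) by (metis mod_eq_dvd_iff_nat)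
    with that(4) have "\<exists>a. \<tau> y' = \<tau> y + a * q"
      by (metis dvd_div_mult_self le_add_diff_inverse)
    then obtain a where a: "\<tau> y' = \<tau> y + a * q" by blast
    have "(F ^^ \<tau> y') x0 = (F ^^ (a * q)) ((F ^^ \<tau> y) x0)"
      by (simp add: a funpow_funpow add.commute)
    also have "(F ^^ \<tau> y) x0 = y + of_int (- \<kappa> y)" using \<tau>[OF that(1)] by linarith
    also have "(F ^^ (a * q)) (y + of_int (- \<kappa> y)) = (F ^^ (a * q)) y + of_int (- \<kappa> y)"
      by (rule circle_lift_plus_int[OF circle_lift_funpow[OF F]])
    also have "(F ^^ (a * q)) y = (H ^^ a) y + of_int (int a * m)" by (simp add: Ha)
    finally have "(H ^^ a) y + of_int (int a * m - \<kappa> y + \<kappa> y') = (F ^^ \<tau> y') x0 + of_int (\<kappa> y')"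
      by simp
    also have "\<dots> = y'" by (rule \<tau>[OF that(2), symmetric])
    finally obtain l :: int where l: "y' = (H ^^ a) y + l" by metis
    have "z < (H ^^ a) y" "(H ^^ a) y < z + 1"
      using that(1) cd fixz[of a] fixz1[of a] circle_lift_less[OF circle_lift_funpow[OF H, of a], of z y]
        circle_lift_less[OF circle_lift_funpow[OF H, of a], of y "z + 1"]
      by (auto simp: S_def)
    moreover have "z < y'" "y' < z + 1" using that(2) cd by (auto simp: S_def)
    ultimately have "l = 0" using l by linarith
    then show ?thesis using l once[of y a] that(1,2) by (auto simp: S_def)
  qed
  have "inj_on (\<lambda>y. \<tau> y mod q) S"
  proof (rule inj_onI)
    fix y y' assume "y \<in> S" "y' \<in> S" "\<tau> y mod q = \<tau> y' mod q"
    then show "y = y'" by (metis same nat_le_linear)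
  qed
  moreover have "(\<lambda>y. \<tau> y mod q) ` S \<subseteq> {..<q}" using q by auto
  ultimately have "finite S" by (rule inj_on_finite) simp
  with \<open>infinite S\<close> show False by simp
qed

section \<open>Jumps of monotone functions\<close>

text \<open>For monotone \<open>G\<close> this is the right limit minus the left limit at
  \<open>t\<close>, that is, the mass of the atom at \<open>t\<close>. Symmetric windows avoid
  one-sided limits.\<close>

definition jump :: "(real \<Rightarrow> real) \<Rightarrow> real \<Rightarrow> real" where
  "jump G t = (INF e\<in>{0<..}. G (t + e) - G (t - e))"

lemma
  assumes "mono G"
  shows jump_nonneg: "jump G t \<ge> 0"
    and jump_le: "e > 0 \<Longrightarrow> jump G t \<le> G (t + e) - G (t - e)"
proof -
  have pos: "0 \<le> G (t + e) - G (t - e)" if "e > 0" for e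
    using monoD[OF assms, of "t - e" "t + e"] that by simp
  show "jump G t \<ge> 0"
    unfolding jump_def by (rule cINF_greatest) (use pos in auto)
  show "jump G t \<le> G (t + e) - G (t - e)" if "e > 0"
    unfolding jump_def by (rule cINF_lower) (use pos that in \<open>auto intro!: bdd_belowI2[of _ 0]\<close>)
qed

lemma jump_less_obtains:
  assumes "jump G t < u"
  obtains e where "e > 0" "G (t + e) - G (t - e) < u"
proof -
  have "\<exists>y\<in>(\<lambda>e. G (t + e) - G (t - e)) ` {0<..}. y < u"
    by (rule cInf_lessD) (use assms in \<open>auto simp: jump_def intro: exI[of _ 1]\<close>)
  then show thesis using that by auto
qed

lemma jump_zero_imp_isCont:
  assumes "mono G" "jump G t = 0"
  shows "isCont G t"
  unfolding continuous_at_eps_delta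
proof (intro allI impI)
  fix r :: real
  assume "r > 0"
  then obtain e where e: "e > 0" "G (t + e) - G (t - e) < r"
    using assms(2) jump_less_obtains by metis
  have "dist (G s) (G t) < r" if "dist s t < e" for s
  proof -
    have "t - e \<le> s" "s \<le> t + e" "t - e \<le> t" "t \<le> t + e"
      using that e by (auto simp: dist_real_def)
    then have "G (t - e) \<le> G s" "G s \<le> G (t + e)" "G (t - e) \<le> G t" "G t \<le> G (t + e)"
      using assms(1) by (simp_all add: monoD)
    then show ?thesis using e by (simp add: dist_real_def)
  qed
  then show "\<exists>e>0. \<forall>s. dist s t < e \<longrightarrow> dist (G s) (G t) < r" using e by blast
qed

text \<open>Disjoint windows around the points have increments of \<open>G\<close> that add up to at
  most the total increment. The induction splits off the largest point \<open>m\<close>: its window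
  lies to the right of \<open>m - e\<close>, and all other points lie to the left.\<close>

lemma sum_jump_le:
  assumes "mono G" "finite S" "a \<le> b" "\<And>s. s \<in> S \<Longrightarrow> a < s \<and> s < b"
  shows "(\<Sum>s\<in>S. jump G s) \<le> G b - G a"
  using assms(2-4)
proof (induction S arbitrary: b rule: finite_linorder_max_induct)
  case empty
  then show ?case using monoD[OF assms(1)] by simp
next
  case (insert m S)
  \<comment> \<open>The first bound on \<open>e\<close> keeps the window below \<open>b\<close>;
    half the gap leaves \<open>m'\<close> strictly to its left.\<close>
  have room: "\<exists>e>0. m + e \<le> b \<and> m' < m - e" if "m' < m" "m < b" for m'
  proof (intro exI conjI)
    show "min (b - m) ((m - m') / 2) > 0" using that by simp
    show "m + min (b - m) ((m - m') / 2) \<le> b" by linarith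
    show "m' < m - min (b - m) ((m - m') / 2)"
      using that min.cobounded2[of "b - m" "(m - m') / 2"] by (simp add: field_simps)
  qed
  have "Max (insert a S) < m" "m < b" using insert by simp_all
  then obtain e where e: "e > 0" "m + e \<le> b" and lt: "Max (insert a S) < m - e"
    using room by blast
  have "(\<Sum>s\<in>S. jump G s) \<le> G (m - e) - G a"
  proof (rule insert.IH)
    show "a \<le> m - e" using lt insert.hyps by simp
    show "a < s \<and> s < m - e" if "s \<in> S" for s
      using that lt insert.hyps insert.prems(2)[of s] by simp
  qed
  moreover have "jump G m \<le> G b - G (m - e)"
    using jump_le[OF assms(1) e(1), of m] monoD[OF assms(1) e(2)] by simp
  moreover have "m \<notin> S" using insert.hyps by blast
  ultimately show ?case using insert.hyps by simp
qed


section \<open>Averaging over a finite family of lifts\<close>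

text \<open>The iterated function system in terms of lifts. In the application the maps in
  \<open>\<Gamma>\<close> serve as indices of their own lifts.\<close>

locale lifted_system =
  fixes I :: "'i set" and p :: "'i \<Rightarrow> real" and F :: "'i \<Rightarrow> real \<Rightarrow> real"
  assumes fin: "finite I"
    and p_pos: "\<And>i. i \<in> I \<Longrightarrow> p i > 0"
    and p_sum: "(\<Sum>i\<in>I. p i) = 1"
    and lift: "\<And>i. i \<in> I \<Longrightarrow> circle_lift (F i)"
begin

text \<open>On periodic functions this is the dual operator read on the line. On the distribution
  function of a measure it gives, up to an additive constant, that of the weighted sum of the images
  of the measure under the inverse maps.\<close>

definition avg :: "(real \<Rightarrow> real) \<Rightarrow> real \<Rightarrow> real" where
  "avg h t = (\<Sum>i\<in>I. p i * h (F i t))"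

lemma mono_avg: "mono h \<Longrightarrow> mono (avg h)"
  unfolding avg_def using p_pos lift
  by (intro monoI sum_mono mult_left_mono) (auto simp: circle_lift_le monoD less_imp_le)

lemma avg_plus_one:
  assumes "\<And>t. h (t + 1) = h t + 1"
  shows "avg h (t + 1) = avg h t + 1"
proof -
  have "avg h (t + 1) = (\<Sum>i\<in>I. p i * h (F i t) + p i)"
    unfolding avg_def using lift assms
    by (intro sum.cong) (auto simp: circle_lift_def distrib_left)
  then show ?thesis by (simp add: sum.distrib p_sum avg_def)
qed

section \<open>Cesaro averages and a stationary distribution function\<close>

lemma funpow_avg_id:
  shows "mono ((avg ^^ n) (\<lambda>t. t))" and "(avg ^^ n) (\<lambda>t. t) (t + 1) = (avg ^^ n) (\<lambda>t. t) t + 1"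
proof -
  have "mono ((avg ^^ n) (\<lambda>t. t)) \<and> (\<forall>t. (avg ^^ n) (\<lambda>t. t) (t + 1) = (avg ^^ n) (\<lambda>t. t) t + 1)"
    by (induction n) (auto simp: mono_avg avg_plus_one intro: monoI)
  then show "mono ((avg ^^ n) (\<lambda>t. t))" and "(avg ^^ n) (\<lambda>t. t) (t + 1) = (avg ^^ n) (\<lambda>t. t) t + 1"
    by auto
qed

text \<open>The averages start from the identity, the distribution function of arc length. Each
  iterate is normalised to vanish at 0, since the iterates may drift by constants.\<close>

definition cesaro :: "nat \<Rightarrow> real \<Rightarrow> real" where
  "cesaro N t = (\<Sum>n<Suc N. (avg ^^ n) (\<lambda>t. t) t - (avg ^^ n) (\<lambda>t. t) 0) / Suc N"

lemma mono_cesaro: "mono (cesaro N)"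
  unfolding cesaro_def
  by (intro monoI divide_right_mono sum_mono diff_right_mono) (auto intro: monoD[OF funpow_avg_id(1)])

lemma cesaro_plus_one: "cesaro N (t + 1) = cesaro N t + 1"
proof -
  have "cesaro N (t + 1) = (\<Sum>n<Suc N. ((avg ^^ n) (\<lambda>t. t) t - (avg ^^ n) (\<lambda>t. t) 0) + 1) / Suc N"
    unfolding cesaro_def by (simp only: funpow_avg_id(2) add_diff_eq diff_add_eq)
  also have "\<dots> = cesaro N t + 1"
    unfolding sum.distrib cesaro_def by (simp add: add_divide_distrib del: sum.lessThan_Suc)
  finally show ?thesis .
qed

lemma abs_cesaro_le: "\<bar>cesaro N t\<bar> \<le> \<bar>t\<bar> + 1"
proof -
  have "cesaro N 0 = 0" by (simp add: cesaro_def)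
  then show ?thesis
    using mono_plus_one_deviation[OF mono_cesaro cesaro_plus_one, of N t] by simp
qed

text \<open>Averaging raises the index of each iterate by one, so the sums telescope to two bounded
  terms divided by \<open>Suc N\<close>. Subtracting the value at 0 removes the drift.\<close>

lemma avg_cesaro:
  "\<bar>avg (cesaro N) t - avg (cesaro N) 0 - cesaro N t\<bar> \<le> 2 * (\<bar>t\<bar> + 1) / Suc N"
proof -
  let ?E = "\<lambda>n. (avg ^^ n) (\<lambda>t. t)"
  have avg: "avg (cesaro N) s = (\<Sum>n<Suc N. ?E (Suc n) s - ?E n 0) / Suc N" for s
  proof -
    have E: "?E (Suc n) s - ?E n 0 = (\<Sum>i\<in>I. p i * (?E n (F i s) - ?E n 0))" for n
      by (simp add: right_diff_distrib sum_subtractf avg_def sum_distrib_right[symmetric] p_sum)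
    have "avg (cesaro N) s = (\<Sum>i\<in>I. \<Sum>n<Suc N. p i * (?E n (F i s) - ?E n 0)) / Suc N"
      by (simp add: avg_def cesaro_def sum_divide_distrib sum_distrib_left del: sum.lessThan_Suc)
    also have "\<dots> = (\<Sum>n<Suc N. \<Sum>i\<in>I. p i * (?E n (F i s) - ?E n 0)) / Suc N"
      by (subst sum.swap) (rule refl)
    finally show ?thesis unfolding E .
  qed
  have "avg (cesaro N) t - avg (cesaro N) 0 - cesaro N t
      = ((\<Sum>n<Suc N. ?E (Suc n) t - ?E n 0) - (\<Sum>n<Suc N. ?E (Suc n) 0 - ?E n 0)
        - (\<Sum>n<Suc N. ?E n t - ?E n 0)) / Suc N"
    unfolding avg cesaro_def by (simp only: diff_divide_distrib)
  also have "(\<Sum>n<Suc N. ?E (Suc n) t - ?E n 0) - (\<Sum>n<Suc N. ?E (Suc n) 0 - ?E n 0)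
        - (\<Sum>n<Suc N. ?E n t - ?E n 0)
      = (\<Sum>n<Suc N. (?E (Suc n) t - ?E (Suc n) 0) - (?E n t - ?E n 0))"
    unfolding sum_subtractf by simp
  also have "\<dots> = (?E (Suc N) t - ?E (Suc N) 0) - (?E 0 t - ?E 0 0)"
    by (rule sum_lessThan_telescope)
  finally have eq: "avg (cesaro N) t - avg (cesaro N) 0 - cesaro N t
      = ((?E (Suc N) t - ?E (Suc N) 0) - (?E 0 t - ?E 0 0)) / Suc N" .
  have bound: "\<bar>?E n t - ?E n 0\<bar> \<le> \<bar>t\<bar> + 1" for n
    by (rule mono_plus_one_deviation[OF funpow_avg_id])
  have "\<bar>(?E (Suc N) t - ?E (Suc N) 0) - (?E 0 t - ?E 0 0)\<bar> \<le> 2 * (\<bar>t\<bar> + 1)"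
    using order.trans[OF abs_triangle_ineq4 add_mono[OF bound bound]] by (simp only: mult_2)
  then show ?thesis unfolding eq abs_divide by (simp add: divide_right_mono)
qed

text \<open>
  Krylov--Bogoliubov for distribution functions: \<open>G\<close> is the distribution function of a measure that
  is stationary for the inverse maps, obtained as a pointwise cluster point by Tychonoff's theorem.
\<close>

lemma obtain_stationary:
  obtains G c where "mono G" "\<And>t. G (t + 1) = G t + 1" "\<And>t. avg G t = G t + c"
proof -
  define K :: "(real \<Rightarrow> real) set" where "K = (\<Pi>\<^sub>E t\<in>UNIV. {- (\<bar>t\<bar> + 1)..\<bar>t\<bar> + 1})"
  have "compactin (product_topology (\<lambda>t. euclidean) UNIV) K"
    unfolding K_def by (subst compactin_PiE) auto
  then have "compact K" unfolding euclidean_product_topology by simp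
  moreover have "cesaro N \<in> K" for N
  proof -
    have "- (\<bar>t\<bar> + 1) \<le> cesaro N t \<and> cesaro N t \<le> \<bar>t\<bar> + 1" for t
      using abs_cesaro_le[of N t] by linarith
    then show ?thesis by (auto simp: K_def)
  qed
  moreover have "filtermap cesaro sequentially \<noteq> bot" by (simp add: filtermap_bot_iff)
  ultimately obtain G where G: "inf (nhds G) (filtermap cesaro sequentially) \<noteq> bot"
    unfolding compact_filter by (auto simp: eventually_filtermap)
  \<comment> \<open>\<open>L\<close> is finer than the neighbourhoods of \<open>G\<close> and than
    the tails of the sequence, so limits along \<open>L\<close> play the role of limits along a
    convergent subnet.\<close>
  define L where "L = inf (nhds G) (filtermap cesaro sequentially)"
  have L: "L \<noteq> bot" "L \<le> nhds G" "L \<le> filtermap cesaro sequentially"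
    using G by (simp_all add: L_def)
  have lim: "((\<lambda>h. h t) \<longlongrightarrow> G t) L" for t
  proof -
    have "((\<lambda>h. h t) \<longlongrightarrow> G t) (at G)"
      using continuous_on_product_coordinates[of t] by (auto simp: continuous_on_def)
    then have "((\<lambda>h. h t) \<longlongrightarrow> G t) (nhds G)"
      by (rule tendsto_at_iff_tendsto_nhds[THEN iffD1])
    then show ?thesis using L(2) by (rule tendsto_mono[rotated])
  qed
  have ev: "eventually P L" if "\<And>N. P (cesaro N)" for P
    by (rule filter_leD[OF L(3)]) (simp add: eventually_filtermap that)
  have "mono G"
  proof (rule monoI)
    fix s t :: real
    assume "s \<le> t"
    then show "G s \<le> G t"
      by (intro tendsto_le[OF L(1) lim lim] ev monoD[OF mono_cesaro])
  qed
  moreover have "G (t + 1) = G t + 1" for t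
  proof (rule tendsto_unique[OF L(1) lim])
    have "((\<lambda>h. h t + 1) \<longlongrightarrow> G t + 1) L" by (intro tendsto_intros lim)
    moreover have "\<forall>\<^sub>F h in L. h t + 1 = h (t + 1)" by (intro ev) (simp add: cesaro_plus_one)
    ultimately show "((\<lambda>h. h (t + 1)) \<longlongrightarrow> G t + 1) L" by (rule Lim_transform_eventually)
  qed
  \<comment> \<open>The error in \<open>avg_cesaro\<close> tends to 0, and finite averages commute
    with the pointwise limit.\<close>
  moreover have "avg G t = G t + avg G 0" for t
  proof -
    have "((\<lambda>h. avg h t - avg h 0 - h t) \<longlongrightarrow> avg G t - avg G 0 - G t) L"
      unfolding avg_def by (intro tendsto_intros lim)
    moreover have "((\<lambda>h. avg h t - avg h 0 - h t) \<longlongrightarrow> 0) (filtermap cesaro sequentially)"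
    proof -
      have "(\<lambda>N. 2 * (\<bar>t\<bar> + 1) / Suc N) \<longlonglongrightarrow> 0"
        using LIMSEQ_Suc[OF lim_const_over_n[of "2 * (\<bar>t\<bar> + 1)"]] by simp
      then have "(\<lambda>N. avg (cesaro N) t - avg (cesaro N) 0 - cesaro N t) \<longlonglongrightarrow> 0"
        by (rule Lim_null_comparison[rotated])
          (auto simp only: real_norm_def intro!: always_eventually avg_cesaro)
      then show "((\<lambda>h. avg h t - avg h 0 - h t) \<longlongrightarrow> 0) (filtermap cesaro sequentially)"
        by (simp add: filterlim_filtermap)
    qed
    then have "((\<lambda>h. avg h t - avg h 0 - h t) \<longlongrightarrow> 0) L"
      using L(3) by (rule tendsto_mono[rotated])
    ultimately show ?thesis using tendsto_unique[OF L(1)] by fastforce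
  qed
  ultimately show thesis by (rule that)
qed

section \<open>Continuity and strict monotonicity of the stationary function\<close>

lemma avg_diff: "avg h v - avg h u = (\<Sum>i\<in>I. p i * (h (F i v) - h (F i u)))"
  by (simp add: avg_def right_diff_distrib sum_subtractf)

text \<open>By the maximum principle a point of maximal jump has an orbit of such points.\<close>

lemma stationary_continuous:
  assumes mono: "mono G" and per: "\<And>t. G (t + 1) = G t + 1" and stat: "\<And>t. avg G t = G t + c"
    and j: "j \<in> I" and dense: "dense_lifted_orbit (F j) x"
  shows "isCont G t"
proof (rule ccontr)
  assume "\<not> isCont G t"
  then have "jump G t \<noteq> 0" using jump_zero_imp_isCont[OF mono] by blast
  then have tpos: "jump G t > 0" using jump_nonneg[OF mono, of t] by simp
  have perk: "G (s + of_int k) = G s + of_int k" for s k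
    using plus_one_imp_plus_int[of G] per by blast
  have jumpk: "jump G (s + of_int k) = jump G s" for s k
  proof -
    have "G (s + of_int k + e) - G (s + of_int k - e) = G (s + e) - G (s - e)" for e
      using perk[of "s + e" k] perk[of "s - e" k] by (simp add: algebra_simps)
    then show ?thesis by (simp add: jump_def)
  qed
  \<comment> \<open>All points of \<open>{0..<1}\<close> lie strictly between -1 and 1, as
    \<open>sum_jump_le\<close> requires, and \<open>G\<close> increases by 2 there.\<close>
  have few: "u * real (card S) \<le> 2" if "finite S" "S \<subseteq> {0..<1}" "\<And>s. s \<in> S \<Longrightarrow> u \<le> jump G s" for S u
  proof -
    have "real (card S) * u \<le> (\<Sum>s\<in>S. jump G s)" using that(3) by (rule sum_bounded_below)
    also have "\<dots> \<le> G 1 - G (-1)" using that(1,2) by (intro sum_jump_le[OF mono]) auto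
    also have "\<dots> = 2" using per[of 0] per[of "-1"] by simp
    finally show ?thesis by (simp add: mult.commute)
  qed
  have jfrac: "jump G (frac s) = jump G s" for s
    using jumpk[of "frac s" "\<lfloor>s\<rfloor>"] by (simp add: frac_def)
  \<comment> \<open>Only finitely many points of a period have a jump at least as large as the one
    at \<open>t\<close>, so a largest jump exists among them and, by periodicity, on the whole
    line.\<close>
  define Big where "Big = {s \<in> {0..<1}. jump G t \<le> jump G s}"
  have "finite Big"
  proof (rule ccontr)
    assume "infinite Big"
    then obtain S where S: "S \<subseteq> Big" "finite S" "card S = nat \<lceil>2 / jump G t\<rceil> + 1"
      using infinite_arbitrarily_large by blast
    have "jump G t * real (card S) \<le> 2"
      by (rule few) (use S in \<open>auto simp: Big_def\<close>)
    moreover have "2 / jump G t < real (card S)" unfolding S(3) by linarith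
    ultimately show False using tpos by (simp add: field_simps)
  qed
  moreover have "frac t \<in> Big" by (simp add: Big_def jfrac frac_ge_0 frac_lt_1)
  ultimately have Max: "Max (jump G ` Big) \<in> jump G ` Big"
    "\<And>s. s \<in> Big \<Longrightarrow> jump G s \<le> Max (jump G ` Big)"
    by (auto intro!: Max_in)
  then obtain s0 where s0: "s0 \<in> Big" "\<And>s. s \<in> Big \<Longrightarrow> jump G s \<le> jump G s0"
    by auto
  define M where "M = jump G s0"
  have M: "jump G s \<le> M" for s
  proof (cases "frac s \<in> Big")
    case True
    then show ?thesis using s0(2)[OF True] by (simp add: M_def jfrac)
  next
    case False
    then have "jump G s < jump G t" by (simp add: Big_def jfrac frac_ge_0 frac_lt_1)
    then show ?thesis using s0(1) by (simp add: M_def Big_def)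
  qed
  have Mpos: "M > 0" using s0(1) tpos by (simp add: M_def Big_def)
  \<comment> \<open>For small \<open>d\<close> every \<open>F i\<close> maps the window of radius
    \<open>d\<close> around \<open>s\<close> into the window of radius \<open>e i\<close> around
    \<open>F i s\<close>; stationarity turns the increment of \<open>G\<close> over the former into
    an average of increments over the images.\<close>
  have sub: "jump G s \<le> (\<Sum>i\<in>I. p i * jump G (F i s))" for s
  proof (rule field_le_epsilon)
    fix r :: real
    assume "r > 0"
    have "\<exists>e>0. G (F i s + e) - G (F i s - e) < jump G (F i s) + r" for i
      using jump_less_obtains[of G "F i s" "jump G (F i s) + r"] \<open>r > 0\<close> by auto
    then obtain e where e: "\<And>i. e i > 0"
      "\<And>i. G (F i s + e i) - G (F i s - e i) < jump G (F i s) + r" by metis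
    have "\<forall>\<^sub>F d in at_right 0. \<forall>i\<in>I. dist (F i (s + d)) (F i s) < e i \<and> dist (F i (s - d)) (F i s) < e i"
    proof (intro eventually_ball_finite fin ballI eventually_conj)
      fix i assume "i \<in> I"
      then have *: "(F i \<longlongrightarrow> F i s) (nhds s)"
        using circle_lift_isCont[OF lift] by (simp add: isCont_def tendsto_at_iff_tendsto_nhds)
      have "((\<lambda>d. s + d) \<longlongrightarrow> s + 0) (at_right 0)" "((\<lambda>d. s - d) \<longlongrightarrow> s - 0) (at_right 0)"
        by (intro tendsto_intros)+
      then have "((\<lambda>d. F i (s + d)) \<longlongrightarrow> F i s) (at_right 0)" "((\<lambda>d. F i (s - d)) \<longlongrightarrow> F i s) (at_right 0)"
        using filterlim_compose[OF *] by simp_all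
      then show "\<forall>\<^sub>F d in at_right 0. dist (F i (s + d)) (F i s) < e i"
        "\<forall>\<^sub>F d in at_right 0. dist (F i (s - d)) (F i s) < e i"
        using e(1)[of i] by (auto dest: tendstoD)
    qed
    then have "\<forall>\<^sub>F d in at_right 0.
        d > 0 \<and> (\<forall>i\<in>I. dist (F i (s + d)) (F i s) < e i \<and> dist (F i (s - d)) (F i s) < e i)"
      by (intro eventually_conj eventually_at_right_less)
    then obtain d where d: "d > 0"
      "\<And>i. i \<in> I \<Longrightarrow> dist (F i (s + d)) (F i s) < e i \<and> dist (F i (s - d)) (F i s) < e i"
      using eventually_happens'[OF trivial_limit_at_right_real] by (metis (no_types, lifting))
    have "jump G s \<le> G (s + d) - G (s - d)" by (rule jump_le[OF mono d(1)])
    also have "\<dots> = (\<Sum>i\<in>I. p i * (G (F i (s + d)) - G (F i (s - d))))"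
      using stat[of "s + d"] stat[of "s - d"] by (simp flip: avg_diff)
    also have "\<dots> \<le> (\<Sum>i\<in>I. p i * (jump G (F i s) + r))"
    proof (rule sum_mono)
      fix i assume i: "i \<in> I"
      have "F i (s + d) \<le> F i s + e i" "F i s - e i \<le> F i (s - d)"
        using d(2)[OF i] by (auto simp: dist_real_def)
      then have "G (F i (s + d)) \<le> G (F i s + e i)" "G (F i s - e i) \<le> G (F i (s - d))"
        using mono by (simp_all add: monoD)
      then show "p i * (G (F i (s + d)) - G (F i (s - d))) \<le> p i * (jump G (F i s) + r)"
        using e(2)[of i] p_pos[OF i] by (intro mult_left_mono) auto
    qed
    also have "\<dots> = (\<Sum>i\<in>I. p i * jump G (F i s)) + r"
      by (simp add: distrib_left sum.distrib sum_distrib_right[symmetric] p_sum)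
    finally show "jump G s \<le> (\<Sum>i\<in>I. p i * jump G (F i s)) + r" .
  qed
  have inv: "jump G (F j s) = M" if "jump G s = M" for s
  proof -
    have nonneg: "p i * (M - jump G (F i s)) \<ge> 0" if "i \<in> I" for i
      using M p_pos[OF that] by simp
    have "(\<Sum>i\<in>I. p i * (M - jump G (F i s))) = M - (\<Sum>i\<in>I. p i * jump G (F i s))"
      by (simp add: right_diff_distrib sum_subtractf sum_distrib_right[symmetric] p_sum)
    also have "\<dots> \<le> 0" using sub[of s] that by simp
    finally have "(\<Sum>i\<in>I. p i * (M - jump G (F i s))) = 0"
      using sum_nonneg[of I "\<lambda>i. p i * (M - jump G (F i s))"] nonneg by fastforce
    then have "p j * (M - jump G (F j s)) = 0"
      using nonneg fin j by (simp add: sum_nonneg_eq_0_iff)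
    then show ?thesis using p_pos[OF j] by simp
  qed
  define orb where "orb n = frac ((F j ^^ n) s0)" for n
  have "jump G ((F j ^^ n) s0) = M" for n
    by (induction n) (simp_all add: M_def[symmetric] inv)
  then have orbM: "jump G (orb n) = M" for n by (simp add: orb_def jfrac)
  \<comment> \<open>A coincidence modulo 1 would be a periodic point of \<open>F j\<close>.\<close>
  have inj: "inj orb"
  proof (rule linorder_injI)
    fix a b :: nat
    assume "a < b"
    show "orb a \<noteq> orb b"
    proof
      assume "orb a = orb b"
      then have "(F j ^^ b) s0 = (F j ^^ a) s0 + of_int (\<lfloor>(F j ^^ b) s0\<rfloor> - \<lfloor>(F j ^^ a) s0\<rfloor>)"
        by (simp add: orb_def frac_def)
      moreover have "(F j ^^ b) s0 = (F j ^^ (b - a)) ((F j ^^ a) s0)"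
        using \<open>a < b\<close> by (simp add: funpow_funpow)
      ultimately show False
        using dense_orbit_no_periodic_point[OF lift[OF j] dense, of "b - a"] \<open>a < b\<close>
        by (metis Suc_leI One_nat_def zero_less_diff)
    qed
  qed
  \<comment> \<open>Enough points for \<open>n\<close> jumps of size \<open>M\<close> to exceed the
    total of 2.\<close>
  define n where "n = nat \<lceil>2 / M\<rceil> + 1"
  have "M * real (card (orb ` {..<n})) \<le> 2"
    by (rule few) (auto simp: orbM, auto simp: orb_def frac_ge_0 frac_lt_1)
  moreover have "card (orb ` {..<n}) = n"
    using inj by (simp add: card_image inj_on_subset)
  moreover have "2 / M < real n" unfolding n_def by linarith
  ultimately show False using Mpos by (simp add: field_simps)
qed

text \<open>
  A flat interval contains two orbit points \<open>y\<close> and \<open>(F j ^^ q) y - m\<close>, so \<open>F j ^^ q - m\<close> maps the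
  level set of \<open>G\<close> through it into itself and has a fixed point there.
\<close>

lemma stationary_strict_mono:
  assumes mono: "mono G" and per: "\<And>t. G (t + 1) = G t + 1" and stat: "\<And>t. avg G t = G t + c"
    and j: "j \<in> I" and dense: "dense_lifted_orbit (F j) x"
  shows "strict_mono G"
proof (rule strict_monoI, rule ccontr)
  fix a b :: real
  assume "a < b" "\<not> G a < G b"
  then have flat: "G a = G b" using monoD[OF mono, of a b] by simp
  have "b < a + 1"
    using flat per[of a] monoD[OF mono, of "a + 1" b] by (cases "b < a + 1") auto
  \<comment> \<open>Stationarity writes the zero increment of \<open>G\<close> as a positively
    weighted sum of nonnegative increments, so each of these is zero: \<open>F j\<close> maps levels
    of \<open>G\<close> into levels.\<close>
  have flow: "G (F j u) = G (F j v)" if "G u = G v" "u \<le> v" for u v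
  proof -
    have nonneg: "p i * (G (F i v) - G (F i u)) \<ge> 0" if "i \<in> I" for i
      using p_pos[OF that] monoD[OF mono, of "F i u" "F i v"]
        circle_lift_le[OF lift[OF that], of u v] \<open>u \<le> v\<close>
      by simp
    have "(\<Sum>i\<in>I. p i * (G (F i v) - G (F i u))) = 0"
      using stat[of u] stat[of v] that by (simp flip: avg_diff)
    then have "p j * (G (F j v) - G (F j u)) = 0"
      using nonneg fin j by (simp add: sum_nonneg_eq_0_iff)
    then show ?thesis using p_pos[OF j] by simp
  qed
  have flow: "G (F j u) = G (F j v)" if "G u = G v" for u v
    by (metis flow linear that)
  have flow: "G ((F j ^^ n) u) = G ((F j ^^ n) v)" if "G u = G v" for u v n
  proof (induction n)
    case (Suc n)
    then show ?case using flow[OF Suc] by (simp only: funpow.simps comp_apply)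
  qed (simp add: that)
  let ?S = "{y. a < y \<and> y < b \<and> (\<exists>n. \<exists>k::int. y = (F j ^^ n) x + k)}"
  have "infinite ?S" by (rule dense_lifted_orbit_infinite[OF dense \<open>a < b\<close>])
  then obtain y1 where y1: "y1 \<in> ?S"
    using infinite_imp_nonempty by blast
  have "infinite (?S - {y1})" using \<open>infinite ?S\<close> by simp
  then obtain y2 where y2: "y2 \<in> ?S" "y2 \<noteq> y1" 
    using infinite_imp_nonempty by blast
  obtain n1 and k1 :: int where n1: "y1 = (F j ^^ n1) x + k1" using y1 by blast
  obtain n2 and k2 :: int where n2: "y2 = (F j ^^ n2) x + k2" using y2 by blast
  \<comment> \<open>Orbit points of equal time differ by an integer, and the flat interval is
    shorter than 1.\<close>
  have "n1 \<noteq> n2"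
  proof
    assume "n1 = n2"
    then have "y1 - y2 = of_int (k1 - k2)" using n1 n2 by simp
    moreover have "\<bar>y1 - y2\<bar> < 1" using y1 y2 \<open>b < a + 1\<close> by auto
    ultimately have "k1 - k2 = 0" by linarith
    then show False using n1 n2 y2 \<open>n1 = n2\<close> by simp
  qed
  \<comment> \<open>The earlier of two orbit points serves as \<open>y\<close>, the time difference
    as \<open>q\<close>, and the difference of the integer shifts as \<open>m\<close>.\<close>
  have ret: "\<exists>y q. \<exists>m::int. q \<ge> 1 \<and> a < y \<and> y < b \<and> a < (F j ^^ q) y - m \<and> (F j ^^ q) y - m < b"
    if "n < n'" "a < (F j ^^ n) x + of_int k" "(F j ^^ n) x + of_int k < b"
      "a < (F j ^^ n') x + of_int k'" "(F j ^^ n') x + of_int k' < b" for n n' k k'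
  proof -
    have "(F j ^^ (n' - n)) ((F j ^^ n) x) = (F j ^^ n') x"
      using \<open>n < n'\<close> by (simp add: funpow_funpow)
    then have "(F j ^^ (n' - n)) ((F j ^^ n) x + of_int k) - of_int (k - k') = (F j ^^ n') x + of_int k'"
      using circle_lift_plus_int[OF circle_lift_funpow[OF lift[OF j]], of "n' - n" "(F j ^^ n) x" k] by simp
    then show ?thesis using that
      by (intro exI[of _ "(F j ^^ n) x + of_int k"] exI[of _ "n' - n"] exI[of _ "k - k'"]) simp
  qed
  obtain y q and m :: int where q: "q \<ge> 1" and y: "a < y" "y < b"
    and ym: "a < (F j ^^ q) y - m" "(F j ^^ q) y - m < b"
    using ret[of n1 n2 k1 k2] ret[of n2 n1 k2 k1] \<open>n1 \<noteq> n2\<close> y1 y2 n1 n2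
    by (metis (mono_tags, lifting) linorder_neqE_nat mem_Collect_eq)
  define H where "H = (\<lambda>t. (F j ^^ q) t - m)"
  have H: "circle_lift H" unfolding H_def
    by (intro circle_lift_diff_int circle_lift_funpow lift j)
  have val: "G s = G a" if "a \<le> s" "s \<le> b" for s
    using flat that monoD[OF mono, of a s] monoD[OF mono, of s b] by simp
  define L where "L = {s. G s = G a}"
  \<comment> \<open>\<open>H\<close> maps the level set into a single level; the return of
    \<open>y\<close> to the flat interval shows that it is the same one.\<close>
  have HL: "H s \<in> L" if "s \<in> L" for s
  proof -
    have perm: "G (s - of_int m) = G s - of_int m" for s
      using plus_one_imp_plus_int[of G s "- m"] per by simp
    have "G s = G y" using that val[of y] y by (simp add: L_def)
    then have "G (H s) = G (H y)" unfolding H_def perm using flow by metis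
    also have "\<dots> = G a" using val[of "H y"] ym by (simp add: H_def)
    finally show ?thesis by (simp add: L_def)
  qed
  have "closed L"
  proof -
    have "continuous_on UNIV G"
      using stationary_continuous[OF assms] by (simp add: continuous_on_eq_continuous_at)
    then show ?thesis unfolding L_def by (intro closed_Collect_eq) auto
  qed
  moreover have "L \<subseteq> {a - 1..a + 1}"
  proof
    fix s assume "s \<in> L"
    then show "s \<in> {a - 1..a + 1}"
      using monoD[OF mono, of "a + 1" s] monoD[OF mono, of s "a - 1"] per[of a] per[of "a - 1"]
      by (cases s "a - 1" rule: linorder_cases; cases s "a + 1" rule: linorder_cases) (auto simp: L_def)
  qed
  ultimately have "compact L"
    by (metis bounded_closed_interval bounded_subset compact_eq_bounded_closed)
  moreover have "a \<in> L" by (simp add: L_def)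
  ultimately obtain l r where l: "l \<in> L" "\<And>s. s \<in> L \<Longrightarrow> l \<le> s" and r: "r \<in> L" "\<And>s. s \<in> L \<Longrightarrow> s \<le> r"
    using compact_attains_inf[of L] compact_attains_sup[of L] by (metis empty_iff)
  \<comment> \<open>\<open>H\<close> points inward at the extreme points of the level set:
    \<open>l \<le> H l\<close> and \<open>H r \<le> r\<close>.\<close>
  have "\<exists>z\<ge>l. z \<le> r \<and> z - H z = 0"
    using HL l r H by (intro IVT')
      (auto simp: circle_lift_def intro!: continuous_intros intro: continuous_on_subset)
  then obtain z where "z - H z = 0" by blast
  then have "(F j ^^ q) z = z + m" by (simp add: H_def)
  then show False using dense_orbit_no_periodic_point[OF lift[OF j] dense q] by blast
qed

section \<open>Equicontinuity of the iterates\<close>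

text \<open>For \<open>n = 0\<close>, close points are handled by uniform continuity, which gives
  \<open>r\<close>, and distant points by the boundedness of \<open>\<phi>\<close>, since
  \<open>G\<close> increases by a definite amount between them. Averaging preserves the estimate
  with the same constants, because it changes increments of \<open>G\<close> not at all.\<close>

lemma equicontinuous_iterates:
  fixes \<phi> G :: "real \<Rightarrow> real"
  assumes \<phi>: "continuous_on UNIV \<phi>" "\<And>t. \<phi> (t + 1) = \<phi> t"
    and G: "continuous_on UNIV G" "strict_mono G" "\<And>t. G (t + 1) = G t + 1" "\<And>t. avg G t = G t + c"
    and "r > 0"
  obtains C where "C \<ge> 0" "\<And>n u v. \<bar>(avg ^^ n) \<phi> v - (avg ^^ n) \<phi> u\<bar> \<le> r + C * \<bar>G v - G u\<bar>"
proof -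
  \<comment> \<open>Adding the identity turns a periodic function into one that increases by 1 over
    each period.\<close>
  have \<phi>k: "\<phi> (t + of_int k) = \<phi> t" for t k
    using plus_one_imp_plus_int[of "\<lambda>t. \<phi> t + t" t k] \<phi>(2) by simp
  have Gk: "G (t + of_int k) = G t + of_int k" for t k
    using plus_one_imp_plus_int[of G t k] G(3) by simp
  have "uniformly_continuous_on {-1..2} \<phi>"
    by (intro compact_uniformly_continuous continuous_on_subset[OF \<phi>(1)]) auto
  then obtain \<rho>0 where \<rho>0: "\<rho>0 > 0"
    "\<And>u v. \<lbrakk>u \<in> {-1..2}; v \<in> {-1..2}; dist v u < \<rho>0\<rbrakk> \<Longrightarrow> dist (\<phi> v) (\<phi> u) < r"
    using \<open>r > 0\<close> unfolding uniformly_continuous_on_def by metis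
  \<comment> \<open>The cap 1 keeps a pair of close points inside \<open>{-1..2}\<close> once the
    left one is shifted into the unit interval.\<close>
  define \<rho> where "\<rho> = min \<rho>0 1"
  have "\<rho> > 0" using \<rho>0 by (simp add: \<rho>_def)
  have near: "\<bar>\<phi> v - \<phi> u\<bar> \<le> r" if "u \<le> v" "v < u + \<rho>" for u v
  proof -
    have "dist (\<phi> (v + of_int (- \<lfloor>u\<rfloor>))) (\<phi> (u + of_int (- \<lfloor>u\<rfloor>))) < r"
    proof (rule \<rho>0(2))
      have "0 \<le> u + of_int (- \<lfloor>u\<rfloor>)" "u + of_int (- \<lfloor>u\<rfloor>) < 1" "\<rho> \<le> 1" "\<rho> \<le> \<rho>0"
        by (simp_all add: \<rho>_def) linarith
      with that show "u + of_int (- \<lfloor>u\<rfloor>) \<in> {-1..2}" "v + of_int (- \<lfloor>u\<rfloor>) \<in> {-1..2}"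
        "dist (v + of_int (- \<lfloor>u\<rfloor>)) (u + of_int (- \<lfloor>u\<rfloor>)) < \<rho>0"
        unfolding atLeastAtMost_iff dist_real_def by linarith+
    qed
    then show ?thesis unfolding \<phi>k by (simp add: dist_real_def)
  qed
  have "bounded (\<phi> ` {0..1})"
    by (intro compact_imp_bounded compact_continuous_image continuous_on_subset[OF \<phi>(1)]) auto
  then obtain B where B: "\<And>t. t \<in> {0..1} \<Longrightarrow> \<bar>\<phi> t\<bar> \<le> B"
    unfolding bounded_iff image_iff real_norm_def by blast
  have B: "\<bar>\<phi> t\<bar> \<le> B" for t
    using B[of "frac t"] \<phi>k[of "frac t" "\<lfloor>t\<rfloor>"] by (simp add: frac_def) linarith
  have "B \<ge> 0" using B[of 0] by linarith
  have "\<exists>u0\<in>{0..1}. \<forall>u\<in>{0..1}. G (u0 + \<rho>) - G u0 \<le> G (u + \<rho>) - G u"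
    by (intro continuous_attains_inf continuous_intros continuous_on_compose2[OF G(1)]
        continuous_on_subset[OF G(1)]) auto
  then obtain u0 where u0: "\<And>u. u \<in> {0..1} \<Longrightarrow> G (u0 + \<rho>) - G u0 \<le> G (u + \<rho>) - G u"
    by blast
  \<comment> \<open>The least increment of \<open>G\<close> over intervals of length
    \<open>\<rho>\<close>. It is attained, hence positive by strict monotonicity.\<close>
  define \<delta> where "\<delta> = G (u0 + \<rho>) - G u0"
  have "\<delta> > 0" using \<open>\<rho> > 0\<close> G(2) by (simp add: \<delta>_def strict_mono_less)
  have \<delta>: "\<delta> \<le> G (u + \<rho>) - G u" for u
  proof -
    have "\<delta> \<le> G (frac u + \<rho>) - G (frac u)"
      unfolding \<delta>_def by (rule u0) (simp add: frac_ge_0 frac_lt_1 less_imp_le)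
    also have "\<dots> = G (u + \<rho>) - G u"
      using Gk[of "frac u + \<rho>" "\<lfloor>u\<rfloor>"] Gk[of "frac u" "\<lfloor>u\<rfloor>"] by (simp add: frac_def algebra_simps)
    finally show ?thesis .
  qed
  \<comment> \<open>Chosen so that \<open>C * \<delta>\<close> equals \<open>2 * B\<close>, a bound
    on the oscillation of \<open>\<phi>\<close>.\<close>
  define C where "C = 2 * B / \<delta>"
  have "C \<ge> 0" using \<open>B \<ge> 0\<close> \<open>\<delta> > 0\<close> by (simp add: C_def)
  have le: "G u \<le> G v" if "u \<le> v" for u v
    using G(2) that by (simp add: strict_mono_less_eq)
  have base: "\<bar>\<phi> v - \<phi> u\<bar> \<le> r + C * (G v - G u)" if "u \<le> v" for u v
  proof (cases "v < u + \<rho>")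
    case True
    have "0 \<le> C * (G v - G u)" using \<open>C \<ge> 0\<close> le[OF that] by simp
    then show ?thesis using near[OF that True] by linarith
  next
    case False
    have "\<bar>\<phi> v - \<phi> u\<bar> \<le> C * \<delta>" using B[of v] B[of u] \<open>\<delta> > 0\<close> by (simp add: C_def)
    also have "\<dots> \<le> C * (G v - G u)"
      using \<delta>[of u] le[of "u + \<rho>" v] False \<open>C \<ge> 0\<close> by (intro mult_left_mono) auto
    finally show ?thesis using \<open>r > 0\<close> by linarith
  qed
  have iter: "\<bar>(avg ^^ n) \<phi> v - (avg ^^ n) \<phi> u\<bar> \<le> r + C * (G v - G u)" if "u \<le> v" for n u v
    using that
  proof (induction n arbitrary: u v)
    case 0
    then show ?case using base by simp
  next
    case (Suc n)
    have "\<bar>(avg ^^ Suc n) \<phi> v - (avg ^^ Suc n) \<phi> u\<bar>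
        \<le> (\<Sum>i\<in>I. \<bar>p i * ((avg ^^ n) \<phi> (F i v) - (avg ^^ n) \<phi> (F i u))\<bar>)"
      by (simp only: funpow.simps comp_apply avg_diff sum_abs)
    also have "\<dots> \<le> (\<Sum>i\<in>I. p i * (r + C * (G (F i v) - G (F i u))))"
    proof (rule sum_mono)
      fix i assume i: "i \<in> I"
      have "F i u \<le> F i v" using circle_lift_le[OF lift[OF i]] Suc.prems by simp
      then show "\<bar>p i * ((avg ^^ n) \<phi> (F i v) - (avg ^^ n) \<phi> (F i u))\<bar>
          \<le> p i * (r + C * (G (F i v) - G (F i u)))"
        using Suc.IH p_pos[OF i] by (simp add: abs_mult)
    qed
    also have "\<dots> = r + C * (avg G v - avg G u)"
      unfolding avg_diff
      by (simp add: distrib_left sum.distrib sum_distrib_right[symmetric] p_sum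
          sum_distrib_left mult.left_commute)
    finally show ?case by (simp add: G(4))
  qed
  have "\<bar>(avg ^^ n) \<phi> v - (avg ^^ n) \<phi> u\<bar> \<le> r + C * \<bar>G v - G u\<bar>" for n u v
  proof (cases "u \<le> v")
    case True
    then show ?thesis using iter[OF True, of n] le[OF True] by simp
  next
    case False
    then have "v \<le> u" by simp
    then show ?thesis using iter[of v u n] le[of v u] by (simp add: abs_minus_commute)
  qed
  with \<open>C \<ge> 0\<close> show thesis by (rule that)
qed

end

section \<open>The circle\<close>

lemma circle_eq_cis:
  assumes "norm x = 1"
  obtains t where "x = cis (2 * pi * t)"
proof -
  have "x \<noteq> 0" using assms by auto
  then have "x = cis (2 * pi * (Arg x / (2 * pi)))"
    using assms cis_Arg[of x] by (auto simp: sgn_div_norm)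
  then show thesis by (rule that)
qed

lemma cis_eq_imp_diff_int:
  assumes "cis (2 * pi * s) = cis (2 * pi * t)"
  obtains k :: int where "s = t + k"
proof -
  obtain k :: int where "2 * pi * s = 2 * pi * t + 2 * pi * k"
    using assms sin_cos_eq_iff by (auto simp: complex_eq_iff)
  then have "2 * pi * s = 2 * pi * (t + k)" by (simp add: distrib_left)
  then have "s = t + k" by simp
  then show thesis by (rule that)
qed

text \<open>Dividing by the centre \<open>x\<close> avoids the branch cut:
  \<open>Arg (y / x)\<close> is continuous at \<open>y = x\<close>, where it is 0, and adding this
  angle, in units of a full turn, to \<open>w\<close> gives a parameter of \<open>y\<close>.\<close>

lemma eventually_local_lift:
  assumes "e > 0"
  shows "\<forall>\<^sub>F y in nhds (cis (2 * pi * w)). norm y = 1 \<longrightarrow> (\<exists>s. \<bar>s - w\<bar> < e \<and> y = cis (2 * pi * s))"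
proof -
  define x where "x = cis (2 * pi * w)"
  have "x \<noteq> 0" by (simp add: x_def)
  have "isCont (\<lambda>y. Arg (y / x)) x"
    using \<open>x \<noteq> 0\<close> by (intro isCont_o2[OF _ continuous_at_Arg] continuous_intros) auto
  then have "((\<lambda>y. Arg (y / x)) \<longlongrightarrow> Arg (x / x)) (nhds x)"
    unfolding continuous_at by (rule tendsto_at_iff_tendsto_nhds[THEN iffD1])
  then have "((\<lambda>y. Arg (y / x)) \<longlongrightarrow> 0) (nhds x)"
    using \<open>x \<noteq> 0\<close> by simp
  then have "\<forall>\<^sub>F y in nhds x. \<bar>Arg (y / x)\<bar> < 2 * pi * e"
    using assms by (auto dest!: tendstoD[of _ _ _ "2 * pi * e"] simp: dist_real_def)
  then show ?thesis unfolding x_def[symmetric]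
  proof eventually_elim
    case (elim y)
    show ?case
    proof
      assume y: "norm y = 1"
      have "norm x = 1" by (simp add: x_def)
      have "cis (2 * pi * (w + Arg (y / x) / (2 * pi))) = x * cis (Arg (y / x))"
        by (simp add: x_def distrib_left cis_mult)
      also have "\<dots> = y"
        using y \<open>norm x = 1\<close> \<open>x \<noteq> 0\<close> by (subst cis_Arg) (auto simp: sgn_div_norm norm_divide)
      finally show "\<exists>s. \<bar>s - w\<bar> < e \<and> y = cis (2 * pi * s)"
        using elim by (intro exI[of _ "w + Arg (y / x) / (2 * pi)"]) (simp add: abs_divide field_simps)
    qed
  qed
qed

text \<open>Points of the circle near the image of the midpoint of \<open>c\<close> and
  \<open>d\<close> have a parameter between \<open>c\<close> and \<open>d\<close>. For an orbit
  point in this neighbourhood, that parameter differs from \<open>(F ^^ n) x\<close> by an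
  integer.\<close>

lemma dense_orbit_imp_dense_lifted_orbit:
  assumes F: "\<And>t. g (cis (2 * pi * t)) = cis (2 * pi * F t)"
    and dense: "circle \<subseteq> closure {(g ^^ n) (cis (2 * pi * x)) |n. n \<ge> 1}"
  shows "dense_lifted_orbit F x"
  unfolding dense_lifted_orbit_def
proof (intro allI impI)
  fix c d :: real
  assume "c < d"
  define w where "w = (c + d) / 2"
  have gn: "(g ^^ n) (cis (2 * pi * x)) = cis (2 * pi * (F ^^ n) x)" for n
    by (induction n) (simp_all add: F)
  have "cis (2 * pi * w) \<in> closure {(g ^^ n) (cis (2 * pi * x)) |n. n \<ge> 1}"
    using dense by auto
  moreover obtain U where "open U" "cis (2 * pi * w) \<in> U"
    and U: "\<And>y. y \<in> U \<Longrightarrow> norm y = 1 \<Longrightarrow> \<exists>s. \<bar>s - w\<bar> < (d - c) / 2 \<and> y = cis (2 * pi * s)"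
    using eventually_local_lift[of "(d - c) / 2" w] \<open>c < d\<close> unfolding eventually_nhds by auto
  ultimately obtain n where "(g ^^ n) (cis (2 * pi * x)) \<in> U"
    unfolding closure_iff_nhds_not_empty by blast
  then obtain s where s: "\<bar>s - w\<bar> < (d - c) / 2" "cis (2 * pi * (F ^^ n) x) = cis (2 * pi * s)"
    using U[of "cis (2 * pi * (F ^^ n) x)"] by (auto simp: gn)
  obtain k :: int where "s = (F ^^ n) x + k"
    using cis_eq_imp_diff_int[OF s(2)[symmetric]] by blast
  moreover have "c < s" "s < d"
    using s(1) by (auto simp: w_def abs_less_iff field_simps)
  ultimately show "\<exists>n. \<exists>k::int. c < (F ^^ n) x + k \<and> (F ^^ n) x + k < d" by blast
qed

section \<open>Transfer of the estimate to the circle\<close>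

theorem proposition15:
  fixes \<Gamma> :: "(complex \<Rightarrow> complex) set"
    and p :: "(complex \<Rightarrow> complex) \<Rightarrow> real"
  assumes "finite \<Gamma>"
    and "\<Gamma> \<subseteq> H_plus"
    and "admissible \<Gamma>"
    and "\<And>g. g \<in> \<Gamma> \<Longrightarrow> p g > 0"
    and "(\<Sum>g\<in>\<Gamma>. p g) = 1"
  shows "e_property \<Gamma> p"
proof -
  have "\<exists>F. circle_lift F \<and> (\<forall>t. g (cis (2 * pi * t)) = cis (2 * pi * F t))" if "g \<in> \<Gamma>" for g
  proof -
    have "orientation_preserving g" using assms(2) that by (auto simp: H_plus_def)
    then show ?thesis by (simp only: orientation_preserving_def circle_lift_def conj_assoc)
  qed
  then obtain F where "\<forall>g\<in>\<Gamma>. circle_lift (F g) \<and> (\<forall>t. g (cis (2 * pi * t)) = cis (2 * pi * F g t))"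
    by (metis bchoice)
  then have F: "\<And>g. g \<in> \<Gamma> \<Longrightarrow> circle_lift (F g)"
    "\<And>g t. g \<in> \<Gamma> \<Longrightarrow> g (cis (2 * pi * t)) = cis (2 * pi * F g t)"
    by simp_all
  have sys: "lifted_system \<Gamma> p F"
    using assms F by unfold_locales auto
  let ?avg = "lifted_system.avg \<Gamma> p F"
  obtain j z where j: "j \<in> \<Gamma>" and z: "norm z = 1" "circle \<subseteq> closure {(j ^^ n) z |n. n \<ge> 1}"
    using assms(3) by (auto simp: admissible_def)
  obtain x0 where "z = cis (2 * pi * x0)" using circle_eq_cis[OF z(1)] .
  then have dense: "dense_lifted_orbit (F j) x0"
    using dense_orbit_imp_dense_lifted_orbit[of j "F j"] F(2)[OF j] z(2) by simp
  obtain G c where G: "mono G" "\<And>t. G (t + 1) = G t + 1" "\<And>t. ?avg G t = G t + c"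
    using lifted_system.obtain_stationary[OF sys] by blast
  have contG: "isCont G t" for t using lifted_system.stationary_continuous[OF sys, OF G j dense] .
  have strictG: "strict_mono G" using lifted_system.stationary_strict_mono[OF sys, OF G j dense] .
  show ?thesis
    unfolding e_property_def
  proof (intro ballI allI impI)
    fix x :: complex and f :: "complex \<Rightarrow> real"
    assume x: "x \<in> circle" and f: "continuous_on circle f"
    let ?D = "\<lambda>n. (dual_operator \<Gamma> p ^^ n) f"
    obtain t where t: "x = cis (2 * pi * t)" using x circle_eq_cis[of x] by auto
    define \<phi> where "\<phi> s = f (cis (2 * pi * s))" for s
    \<comment> \<open>The covering map intertwines the dual operator with the average over the
      lifts.\<close>
    have D: "?D n (cis (2 * pi * s)) = (?avg ^^ n) \<phi> s" for n s
      by (induction n arbitrary: s) (simp_all add: \<phi>_def dual_operator_def lifted_system.avg_def[OF sys] F(2))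
    have cont\<phi>: "continuous_on UNIV \<phi>"
      unfolding \<phi>_def by (intro continuous_on_compose2[OF f] continuous_intros) auto
    have per\<phi>: "\<phi> (s + 1) = \<phi> s" for s
      by (simp add: \<phi>_def distrib_left flip: cis_mult)
    show "((\<lambda>y. SUP n. \<bar>?D n y - ?D n x\<bar>) \<longlongrightarrow> 0) (at x within circle)"
    proof (rule tendstoI)
      fix r :: real
      assume "r > 0"
      obtain C where C: "C \<ge> 0"
        "\<And>n u v. \<bar>(?avg ^^ n) \<phi> v - (?avg ^^ n) \<phi> u\<bar> \<le> r / 3 + C * \<bar>G v - G u\<bar>"
        using lifted_system.equicontinuous_iterates[OF sys, OF cont\<phi> per\<phi> _ strictG G(2,3), of "r / 3"] contG \<open>r > 0\<close>
        by (auto simp: continuous_on_eq_continuous_at)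
      \<comment> \<open>With this tolerance for \<open>G\<close> the term with factor
        \<open>C\<close> is at most \<open>r / 3\<close>; \<open>C + 1\<close> guards against
        division by zero.\<close>
      have "r / (3 * (C + 1)) > 0" using \<open>r > 0\<close> C(1) by simp
      then obtain e where e: "e > 0" "\<And>s. \<bar>s - t\<bar> < e \<Longrightarrow> \<bar>G s - G t\<bar> < r / (3 * (C + 1))"
        using contG[of t] unfolding continuous_at_eps_delta dist_real_def by metis
      have "\<forall>\<^sub>F y in at x within circle. y \<in> circle"
        by (simp add: eventually_at_topological) auto
      moreover have "\<forall>\<^sub>F y in at x within circle. norm y = 1 \<longrightarrow> (\<exists>s. \<bar>s - t\<bar> < e \<and> y = cis (2 * pi * s))"
        using eventually_local_lift[OF e(1), of t] unfolding t
        by (rule filter_leD[OF at_within_le_nhds])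
      ultimately show "\<forall>\<^sub>F y in at x within circle. dist (SUP n. \<bar>?D n y - ?D n x\<bar>) 0 < r"
      proof eventually_elim
        case (elim y)
        then obtain s where s: "\<bar>s - t\<bar> < e" "y = cis (2 * pi * s)" by auto
        have "C * \<bar>G s - G t\<bar> \<le> C * (r / (3 * (C + 1)))"
          using e(2)[OF s(1)] C(1) by (intro mult_left_mono) auto
        also have "\<dots> \<le> r / 3" using C(1) \<open>r > 0\<close> by (simp add: field_simps)
        finally have bound: "\<bar>?D n y - ?D n x\<bar> \<le> 2 * r / 3" for n
          using C(2)[of n s t] by (simp add: s(2) t D)
        have "(SUP n. \<bar>?D n y - ?D n x\<bar>) \<le> 2 * r / 3"
          by (rule cSUP_least) (use bound in auto)
        \<comment> \<open>Any single term shows that the supremum is nonnegative, so its distance to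
          0 is its value.\<close>
        moreover have "\<bar>?D 0 y - ?D 0 x\<bar> \<le> (SUP n. \<bar>?D n y - ?D n x\<bar>)"
          by (rule cSUP_upper) (use bound in \<open>auto intro: bdd_aboveI2[of _ _ "2 * r / 3"]\<close>)
        ultimately show ?case using \<open>r > 0\<close> by simp
      qed
    qed
  qed
qed

end
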